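(* Let $n>9$ and $p\in(0,1)$. Define $q=1-p$, $\alpha=\min\{p,q\}$, and $\beta=\max\{p,q\}$. Then \[N_n(p)\le\sum_{w=9}^{73}N_{9,w}\,p^{w}q^{81-w}\prod_{k\in T_p}\left[1-\Big(2q^k-q^{2k-1}+2\big((p^2+q^2)\alpha^{k-10}-q^k\beta^{k-10}\big)g(w)-\beta^{2k-19}g(w)^2\Big)\right],\] where $g(w)=9\,p^{\frac w9}q^{9-\frac w9}$ and \[T_p=\left\{k\in\mathbb{N}\,:\,10\le k\le n,\;(p^2+q^2)\alpha^{k-10}\ge q^k\beta^{k-10}+(p+8\alpha)\beta^{2k-11}\right\}.\]
   Context: An $n\times n$ matrix is strongly non-singular if its leading $k\times k$ principal minor is non-zero (over $\mathbb{R}$) for every $k\in\{1,\dots,n\}$. $N_n(p)$ denotes the probability that an $n\times n$ random matrix with independent $\mathrm{Ber}(p)$ entries (equal to $1$ with probability $p$ and $0$ with probability $1-p$) is strongly non-singular. $N_{9,w}$ denotes the number of strongly non-singular matrices in $\{0,1\}^{9\times9}$ with exactly $w$ entries equal to $1$ ($N_{9,w}=0$ unless $9\le w\le73$). *)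

theory Defs
  imports
    "HOL-Probability.Product_PMF"
    "Jordan_Normal_Form.Determinant"
    "Jordan_Normal_Form.DL_Submatrix"
begin

text \<open>Row and column indices start at 0, so the leading \<open>k\<close> rows and columns are \<open>{..<k}\<close>.\<close>

definition strongly_nonsingular :: "real mat \<Rightarrow> bool" where
  "strongly_nonsingular A \<longleftrightarrow>
     square_mat A \<and> (\<forall>k\<in>{1..dim_row A}. Determinant.det (submatrix A {..<k} {..<k}) \<noteq> 0)"

definition bernoulli_mat :: "nat \<Rightarrow> real \<Rightarrow> real mat pmf" where
  "bernoulli_mat n p =
     map_pmf (\<lambda>b. Matrix.mat n n (\<lambda>ij. of_bool (b ij)))
       (Pi_pmf ({..<n} \<times> {..<n}) False (\<lambda>_. bernoulli_pmf p))"

definition prob_strongly_nonsingular :: "nat \<Rightarrow> real \<Rightarrow> real" where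
  "prob_strongly_nonsingular n p =
     measure_pmf.prob (bernoulli_mat n p) {A. strongly_nonsingular A}"

definition num_strongly_nonsingular :: "nat \<Rightarrow> nat \<Rightarrow> nat" where
  "num_strongly_nonsingular n w =
     card {A \<in> carrier_mat n n.
             elements_mat A \<subseteq> {0, 1} \<and>
             card {(i, j). i < n \<and> j < n \<and> A $$ (i, j) = 1} = w \<and>
             strongly_nonsingular A}"

end

theory Submission
  imports Defs
begin

text \<open>
  Reveal the matrix one bordering row and column at a time. Given a nonsingular leading
  \<open>m \<times> m\<close> block, the block of size \<open>k = m + 1\<close> is singular as soon as its last column is zero or
  repeats one of the first nine columns, or the same happens for its last row. Columns of a
  nonsingular block are distinct and nonzero, so inclusion-exclusion gives the probability of this
  event in terms of the probabilities \<open>X\<close>, \<open>Y\<close> that the new border, without its corner, repeats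
  one of the first nine columns or rows. These are controlled by the leading \<open>9 \<times> 9\<close> block up to
  factors \<open>\<alpha> ^ (k - 10)\<close> and \<open>\<beta> ^ (k - 10)\<close>; for that block the AM-GM inequality bounds them
  below by \<open>g w\<close>, and distinctness of the columns bounds them above by \<open>(p + 8 * \<alpha>) * \<beta> ^ 8\<close>.
  The condition defining \<open>T\<close> makes the resulting bilinear bound increasing on this
  range, so that both can be replaced by \<open>g w\<close>.
\<close>

subsection \<open>Nonsingular 0/1 matrices\<close>

text \<open>A single function on all index pairs encodes every leading block at once: for
  \<open>k \<le> m\<close>, \<open>bmat k b\<close> is the leading block of
  \<open>bmat m b\<close>.\<close>

definition bmat :: "nat \<Rightarrow> (nat \<times> nat \<Rightarrow> bool) \<Rightarrow> real mat" where
  "bmat m b = Matrix.mat m m (\<lambda>x. of_bool (b x))"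

definition grid :: "nat \<Rightarrow> (nat \<times> nat) set" where
  "grid m = {..<m} \<times> {..<m}"

lemma finite_grid [simp]: "finite (grid m)"
  by (simp add: grid_def)

lemma mem_grid [simp]: "(i, j) \<in> grid m \<longleftrightarrow> i < m \<and> j < m"
  by (simp add: grid_def)

lemma grid_mono: "m \<le> n \<Longrightarrow> grid m \<subseteq> grid n"
  by (auto simp: grid_def)

lemma bmat_carrier [simp]: "bmat m b \<in> carrier_mat m m"
  by (simp add: bmat_def)

lemma dim_bmat [simp]: "dim_row (bmat m b) = m" "dim_col (bmat m b) = m"
  by (simp_all add: bmat_def)

lemma index_bmat [simp]: "i < m \<Longrightarrow> j < m \<Longrightarrow> bmat m b $$ (i, j) = of_bool (b (i, j))"
  by (simp add: bmat_def)

lemma bmat_cong: "(\<And>x. x \<in> grid m \<Longrightarrow> b x = c x) \<Longrightarrow> bmat m b = bmat m c"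
  by (auto simp: bmat_def intro!: eq_matI)

text \<open>Composition with \<open>prod.swap\<close> is how facts about rows are obtained below
  from facts about columns.\<close>

lemma bmat_swap: "bmat m (b \<circ> prod.swap) = transpose_mat (bmat m b)"
  by (auto simp: bmat_def intro!: eq_matI)

lemma det_bmat_swap: "Determinant.det (bmat m (b \<circ> prod.swap)) = Determinant.det (bmat m b)"
  by (simp add: bmat_swap det_transpose[of _ m])

lemma det_bmat_eq_columns:
  assumes "i < m" "j < m" "i \<noteq> j" "\<And>l. l < m \<Longrightarrow> b (l, i) = b (l, j)"
  shows "Determinant.det (bmat m b) = 0"
proof (rule det_identical_columns[OF bmat_carrier \<open>i \<noteq> j\<close> \<open>i < m\<close> \<open>j < m\<close>])
  show "Matrix.col (bmat m b) i = Matrix.col (bmat m b) j"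
    using assms by (intro eq_vecI) auto
qed

lemma det_bmat_zero_column:
  assumes "j < m" "\<And>l. l < m \<Longrightarrow> \<not> b (l, j)"
  shows "Determinant.det (bmat m b) = 0"
proof -
  have "bmat m b *\<^sub>v unit_vec m j = 0\<^sub>v m"
    using assms by (intro eq_vecI) auto
  moreover have "unit_vec m j \<noteq> (0\<^sub>v m :: real Matrix.vec)"
    using assms by simp
  ultimately show ?thesis
    using det_0_iff_vec_prod_zero[OF bmat_carrier] unit_vec_carrier by blast
qed

lemma nonsingular_columns_distinct:
  assumes "Determinant.det (bmat m b) \<noteq> 0" "i < m" "j < m" "i \<noteq> j"
  obtains l where "l < m" "b (l, i) \<noteq> b (l, j)"
  using det_bmat_eq_columns assms by metis

lemma nonsingular_column_nonzero:
  assumes "Determinant.det (bmat m b) \<noteq> 0" "j < m"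
  obtains l where "l < m" "b (l, j)"
  using det_bmat_zero_column assms by metis

section \<open>Leading principal minors\<close>

definition minors_nonzero :: "nat \<Rightarrow> (nat \<times> nat \<Rightarrow> bool) \<Rightarrow> bool" where
  "minors_nonzero m b \<longleftrightarrow> (\<forall>k\<in>{1..m}. Determinant.det (bmat k b) \<noteq> 0)"

lemma minors_nonzero_cong:
  assumes "\<And>x. x \<in> grid m \<Longrightarrow> b x = c x"
  shows "minors_nonzero m b = minors_nonzero m c"
proof -
  have "bmat k b = bmat k c" if "k \<in> {1..m}" for k
    using that assms grid_mono[of k m] by (intro bmat_cong) auto
  then show ?thesis by (simp add: minors_nonzero_def)
qed

lemma minors_nonzero_Suc:
  "minors_nonzero (Suc m) b \<longleftrightarrow> minors_nonzero m b \<and> Determinant.det (bmat (Suc m) b) \<noteq> 0"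
  by (auto simp: minors_nonzero_def atLeastAtMostSuc_conv)

lemma minors_nonzero_mono: "minors_nonzero m b \<Longrightarrow> k \<le> m \<Longrightarrow> minors_nonzero k b"
  by (auto simp: minors_nonzero_def)

lemma minors_nonzero_det: "minors_nonzero m b \<Longrightarrow> 1 \<le> m \<Longrightarrow> Determinant.det (bmat m b) \<noteq> 0"
  by (auto simp: minors_nonzero_def)

lemma pick_lessThan: "i < k \<Longrightarrow> pick {..<k} i = i"
proof -
  assume "i < k"
  then have "{a \<in> {..<k}. a < i} = {..<i}" by auto
  with pick_card_in_set[of i "{..<k}"] \<open>i < k\<close> show ?thesis by simp
qed

lemma submatrix_bmat: "k \<le> m \<Longrightarrow> submatrix (bmat m b) {..<k} {..<k} = bmat k b"
proof -
  assume "k \<le> m"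
  then have [simp]: "{i. i < m \<and> i < k} = {..<k}" by auto
  from \<open>k \<le> m\<close> show ?thesis
    by (intro eq_matI) (simp_all add: dim_submatrix submatrix_index pick_lessThan)
qed

lemma strongly_nonsingular_bmat: "strongly_nonsingular (bmat m b) \<longleftrightarrow> minors_nonzero m b"
  by (simp add: strongly_nonsingular_def minors_nonzero_def submatrix_bmat)

subsection \<open>Configurations of a block\<close>

text \<open>The default \<open>False\<close> outside the grid makes each block correspond to exactly
  one function, so the cylinders \<open>agree m b\<close> with \<open>b\<close> in
  \<open>conf m\<close> form a finite partition.\<close>

definition conf :: "nat \<Rightarrow> (nat \<times> nat \<Rightarrow> bool) set" where
  "conf m = PiE_dflt (grid m) False (\<lambda>_. UNIV)"

definition agree :: "nat \<Rightarrow> (nat \<times> nat \<Rightarrow> bool) \<Rightarrow> (nat \<times> nat \<Rightarrow> bool) set" where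
  "agree m b = {h. \<forall>x\<in>grid m. h x = b x}"

definition ones :: "(nat \<times> nat \<Rightarrow> bool) \<Rightarrow> nat" where
  "ones b = card {x \<in> grid 9. b x}"

lemma finite_conf [simp]: "finite (conf m)"
  unfolding conf_def by (intro finite_PiE_dflt) auto

lemma conf_outside: "b \<in> conf m \<Longrightarrow> x \<notin> grid m \<Longrightarrow> \<not> b x"
  unfolding conf_def PiE_dflt_def mem_Collect_eq by metis

lemma agree_disjoint: "disjoint_family_on (agree m) (conf m)"
proof -
  have "b = c" if "b \<in> conf m" "c \<in> conf m" "h \<in> agree m b" "h \<in> agree m c" for b c h
  proof
    fix x show "b x = c x"
      using that conf_outside[of b m x] conf_outside[of c m x]
      by (cases "x \<in> grid m") (auto simp: agree_def simp del: split_paired_All)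
  qed
  then show ?thesis by (auto simp: disjoint_family_on_def)
qed

lemma agree_cover: "\<exists>b\<in>conf m. h \<in> agree m b"
  by (rule bexI[of _ "\<lambda>x. x \<in> grid m \<and> h x"]) (auto simp: conf_def agree_def PiE_dflt_def)

text \<open>Law of total probability over the leading block. Conditioning on the block is expressed
  by intersecting with its cylinder, without division.\<close>

lemma prob_conf_sum:
  "measure_pmf.prob P A = (\<Sum>b\<in>conf m. measure_pmf.prob P (A \<inter> agree m b))"
proof -
  have "A = (\<Union>b\<in>conf m. A \<inter> agree m b)"
    using agree_cover by blast
  moreover have "measure_pmf.prob P (\<Union>b\<in>conf m. A \<inter> agree m b)
      = (\<Sum>b\<in>conf m. measure_pmf.prob P (A \<inter> agree m b))"
    using agree_disjoint[of m]
    by (intro measure_pmf.finite_measure_finite_Union) (auto simp: disjoint_family_on_def)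
  ultimately show ?thesis by simp
qed

section \<open>The number of ones in the leading 9 x 9 block\<close>

lemma ones_le: "ones b \<le> 81"
proof -
  have "ones b \<le> card (grid 9)"
    unfolding ones_def by (intro card_mono) auto
  then show ?thesis by (simp add: grid_def)
qed

lemma ones_swap: "ones (b \<circ> prod.swap) = ones b"
proof -
  have eq: "{x \<in> grid 9. b x} = prod.swap ` {x \<in> grid 9. (b \<circ> prod.swap) x}"
    by (force simp: image_iff)
  show ?thesis
    unfolding ones_def eq by (subst card_image) (auto simp: inj_on_def)
qed

lemma ones_sum: "ones b = (\<Sum>j<9. card {i. i < 9 \<and> b (i, j)})"
proof -
  have "{x \<in> grid 9. b x} = (\<Union>j<9. (\<lambda>i. (i, j)) ` {i. i < 9 \<and> b (i, j)})"
    by auto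
  also have "card \<dots> = (\<Sum>j<9. card ((\<lambda>i. (i, j)) ` {i. i < 9 \<and> b (i, j)}))"
    by (intro card_UN_disjoint) auto
  also have "\<dots> = (\<Sum>j<9. card {i. i < 9 \<and> b (i, j)})"
    by (intro sum.cong refl card_image) (auto simp: inj_on_def)
  finally show ?thesis by (simp add: ones_def)
qed

text \<open>Every column of a nonsingular block contains a one, which gives 9. At most one column
  consists of ones only, since the columns are distinct, which gives 9 + 8 * 8 = 73.\<close>

lemma ones_bounds:
  assumes "Determinant.det (bmat 9 b) \<noteq> 0"
  shows "9 \<le> ones b" "ones b \<le> 73"
proof -
  let ?c = "\<lambda>j. card {i. i < 9 \<and> b (i, j)}"
  have pos: "1 \<le> ?c j" if "j < 9" for j
  proof -
    obtain l where "l < 9" "b (l, j)"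
      using nonsingular_column_nonzero[OF assms \<open>j < 9\<close>] .
    then have "{i. i < 9 \<and> b (i, j)} \<noteq> {}" by auto
    then have "card {i. i < 9 \<and> b (i, j)} \<noteq> 0" by (subst card_0_eq) auto
    then show ?thesis by linarith
  qed
  have "(\<Sum>j<9::nat. 1) \<le> (\<Sum>j<9. ?c j)"
    using pos by (intro sum_mono) auto
  then show "9 \<le> ones b" by (simp add: ones_sum)
  have le9: "?c j \<le> 9" for j
    using card_mono[of "{..<9::nat}" "{i. i < 9 \<and> b (i, j)}"] by auto
  have full: "\<forall>i<9. b (i, j)" if "?c j = 9" for j
  proof -
    have "{i. i < 9 \<and> b (i, j)} = {..<9}"
      using that by (intro card_subset_eq) auto
    then show ?thesis by auto
  qed
  have "\<exists>j0<9. \<forall>j<9. j \<noteq> j0 \<longrightarrow> ?c j \<le> 8"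
  proof (cases "\<exists>j0<9. ?c j0 = 9")
    case True
    then obtain j0 where j0: "j0 < 9" "?c j0 = 9" by blast
    have "?c j \<le> 8" if "j < 9" "j \<noteq> j0" for j
    proof (rule ccontr)
      assume "\<not> ?c j \<le> 8"
      then have "?c j = 9" using le9[of j] by linarith
      then show False
        using full[of j] full[OF j0(2)] nonsingular_columns_distinct[OF assms that(1) j0(1) that(2)]
        by metis
    qed
    with j0 show ?thesis by blast
  next
    case False
    have "?c j \<le> 8" if "j < 9" for j
    proof -
      have "?c j \<noteq> 9" using False that by blast
      then show ?thesis using le9[of j] by linarith
    qed
    then show ?thesis by (intro exI[of _ 0]) auto
  qed
  then obtain j0 where j0: "j0 < 9" "\<And>j. j < 9 \<Longrightarrow> j \<noteq> j0 \<Longrightarrow> ?c j \<le> 8" by blast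
  have "(\<Sum>j<9. ?c j) = ?c j0 + (\<Sum>j\<in>{..<9} - {j0}. ?c j)"
    using j0(1) by (subst sum.remove[of _ j0]) auto
  also have "\<dots> \<le> 9 + (\<Sum>j\<in>{..<9} - {j0}. 8)"
    using j0 le9 by (intro add_mono sum_mono) auto
  also have "\<dots> = 73" using j0(1) by simp
  finally show "ones b \<le> 73" by (simp add: ones_sum)
qed

text \<open>\<open>bmat 9\<close> is a bijection from these configurations to the counted matrices;
  it is injective because members of \<open>conf 9\<close> are fixed to \<open>False\<close> outside
  the grid.\<close>

lemma num_strongly_nonsingular_eq:
  "num_strongly_nonsingular 9 w = card {b \<in> conf 9. minors_nonzero 9 b \<and> ones b = w}"
proof -
  let ?F = "{b \<in> conf 9. minors_nonzero 9 b \<and> ones b = w}"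
  let ?M = "{A \<in> carrier_mat 9 9. elements_mat A \<subseteq> {0, 1} \<and>
     card {(i, j). i < 9 \<and> j < 9 \<and> A $$ (i, j) = 1} = w \<and> strongly_nonsingular A}"
  have ones_set: "{(i, j). i < 9 \<and> j < 9 \<and> bmat 9 b $$ (i, j) = 1} = {x \<in> grid 9. b x}" for b
    by (auto simp: of_bool_def split: if_splits)
  have "bij_betw (bmat 9) ?F ?M"
  proof (rule bij_betwI')
    fix b c assume b: "b \<in> ?F" and c: "c \<in> ?F"
    show "bmat 9 b = bmat 9 c \<longleftrightarrow> b = c"
    proof
      assume eq: "bmat 9 b = bmat 9 c"
      show "b = c"
      proof
        fix x show "b x = c x"
        proof (cases "x \<in> grid 9")
          case True
          obtain i j where x: "x = (i, j)" by (cases x)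
          with True have "bmat 9 b $$ (i, j) = of_bool (b x)" "bmat 9 c $$ (i, j) = of_bool (c x)"
            by auto
          with eq show ?thesis by (metis of_bool_eq_iff)
        next
          case False
          with b c show ?thesis using conf_outside by blast
        qed
      qed
    qed simp
  next
    fix b assume "b \<in> ?F"
    moreover have "elements_mat (bmat 9 b) \<subseteq> {0, 1}"
      by (auto simp: elements_mat_def)
    ultimately show "bmat 9 b \<in> ?M"
      by (auto simp: ones_set ones_def strongly_nonsingular_bmat)
  next
    fix A assume A: "A \<in> ?M"
    define b where "b = (\<lambda>x. x \<in> grid 9 \<and> A $$ x = 1)"
    have el: "A $$ (i, j) \<in> {0, 1}" if "i < 9" "j < 9" for i j
    proof -
      have "A $$ (i, j) \<in> elements_mat A" using A that by (intro elements_matI) auto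
      with A show ?thesis by blast
    qed
    have eq: "A = bmat 9 b"
      using A el by (intro eq_matI) (force simp: b_def)+
    have "b \<in> conf 9" by (auto simp: b_def conf_def PiE_dflt_def)
    moreover have "ones b = w"
      using A ones_set[of b] unfolding eq[symmetric] by (simp add: ones_def)
    ultimately show "\<exists>b\<in>?F. A = bmat 9 b"
      using A eq strongly_nonsingular_bmat by auto
  qed
  then show ?thesis
    by (simp add: num_strongly_nonsingular_def bij_betw_same_card)
qed

text \<open>Continuing by the identity shows that a 9 x 9 block with nonzero leading minors extends
  to such a block of every larger size, as \<open>gain_le_1\<close> requires.\<close>

definition identity_extension :: "(nat \<times> nat \<Rightarrow> bool) \<Rightarrow> nat \<times> nat \<Rightarrow> bool" where
  "identity_extension f = (\<lambda>(i, j). if i < 9 \<and> j < 9 then f (i, j) else i = j)"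

text \<open>The bordered matrix is block lower triangular with corner 1.\<close>

lemma det_bmat_Suc_unit_column:
  assumes "\<And>i. i < m \<Longrightarrow> \<not> b (i, m)" "b (m, m)"
  shows "Determinant.det (bmat (Suc m) b) = Determinant.det (bmat m b)"
proof -
  let ?r = "Matrix.mat 1 m (\<lambda>(i, k). of_bool (b (m, k)))"
  have "bmat (Suc m) b = four_block_mat (bmat m b) (0\<^sub>m m 1) ?r (1\<^sub>m 1)"
    using assms by (intro eq_matI) (auto simp: four_block_mat_def Let_def less_Suc_eq)
  also have "Determinant.det \<dots> = Determinant.det (bmat m b) * Determinant.det (1\<^sub>m 1)"
    by (intro det_four_block_mat_upper_right_zero_col) auto
  finally show ?thesis by simp
qed

lemma minors_nonzero_identity_extension:
  assumes "minors_nonzero 9 f" "9 \<le> m"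
  shows "minors_nonzero m (identity_extension f)"
  using assms(2)
proof (induction m rule: dec_induct)
  case base
  have "minors_nonzero 9 (identity_extension f) \<longleftrightarrow> minors_nonzero 9 f"
    by (rule minors_nonzero_cong) (auto simp: identity_extension_def grid_def)
  with assms(1) show ?case by simp
next
  case (step m)
  have "Determinant.det (bmat (Suc m) (identity_extension f))
      = Determinant.det (bmat m (identity_extension f))"
    using step.hyps by (intro det_bmat_Suc_unit_column) (auto simp: identity_extension_def)
  with step.IH step.hyps(1) show ?case
    by (simp add: minors_nonzero_Suc minors_nonzero_det)
qed

subsection \<open>Two real inequalities\<close>

text \<open>Right side minus left side equals
  \<open>(x - g) * (a - c * y) + (y - g) * (a - c * g)\<close>. All four factors are nonnegative, as
  \<open>y\<close> and \<open>g\<close> are at most \<open>M\<close> and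
  \<open>c * M \<le> a\<close>.\<close>

lemma bilinear_lower_bound:
  fixes a c g M x y :: real
  assumes "g \<le> x" "x \<le> M" "g \<le> y" "y \<le> M" "0 \<le> c" "c * M \<le> a"
  shows "2 * a * g - c * g^2 \<le> a * (x + y) - c * x * y"
proof -
  have *: "0 \<le> a - c * z" if "z \<le> M" for z
    using mult_left_mono[OF that \<open>0 \<le> c\<close>] \<open>c * M \<le> a\<close> by linarith
  have "0 \<le> (x - g) * (a - c * y)" "0 \<le> (y - g) * (a - c * g)"
    using assms * by (auto intro!: mult_nonneg_nonneg)
  then show ?thesis
    by (simp add: algebra_simps power2_eq_square)
qed

text \<open>AM-GM from \<open>1 + t \<le> exp t\<close> at \<open>t = ln (x i) - \<mu>\<close>:
  these deviations from the mean logarithm sum to zero.\<close>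

lemma sum_ge_card_geometric_mean:
  fixes x :: "'a \<Rightarrow> real"
  assumes "finite A" "A \<noteq> {}" "\<And>i. i \<in> A \<Longrightarrow> 0 < x i"
  shows "card A * (\<Prod>i\<in>A. x i) powr (1 / card A) \<le> (\<Sum>i\<in>A. x i)"
proof -
  let ?n = "real (card A)"
  define \<mu> where "\<mu> = (\<Sum>i\<in>A. ln (x i)) / ?n"
  have n: "?n > 0" using assms by (simp add: card_gt_0_iff)
  have \<mu>: "(\<Prod>i\<in>A. x i) powr (1 / ?n) = exp \<mu>"
  proof -
    have "(\<Prod>i\<in>A. x i) > 0" using assms by (simp add: prod_pos)
    moreover have "ln (\<Prod>i\<in>A. x i) = (\<Sum>i\<in>A. ln (x i))"
      by (intro ln_prod assms(1)) (metis assms(3) less_irrefl)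
    ultimately show ?thesis by (simp add: powr_def \<mu>_def)
  qed
  have "exp \<mu> * (1 + (ln (x i) - \<mu>)) \<le> x i" if "i \<in> A" for i
  proof -
    have "exp \<mu> * (1 + (ln (x i) - \<mu>)) \<le> exp \<mu> * exp (ln (x i) - \<mu>)"
      by (intro mult_left_mono exp_ge_add_one_self) auto
    also have "\<dots> = x i" using assms(3)[OF that] by (simp flip: exp_add)
    finally show ?thesis .
  qed
  then have "(\<Sum>i\<in>A. exp \<mu> * (1 + (ln (x i) - \<mu>))) \<le> (\<Sum>i\<in>A. x i)"
    by (rule sum_mono)
  also have "(\<Sum>i\<in>A. exp \<mu> * (1 + (ln (x i) - \<mu>))) = exp \<mu> * (\<Sum>i\<in>A. 1 + (ln (x i) - \<mu>))"
    by (simp add: sum_distrib_left)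
  also have "(\<Sum>i\<in>A. 1 + (ln (x i) - \<mu>)) = ?n"
    using n by (simp add: sum.distrib sum_subtractf \<mu>_def)
  finally show ?thesis by (simp add: \<mu> mult.commute)
qed

subsection \<open>Probabilities of bordered configurations\<close>

locale bernoulli_entries =
  fixes p :: real
  assumes p_pos: "0 < p" and p_less_1: "p < 1"
begin

abbreviation "q \<equiv> 1 - p"

definition bits :: "nat \<Rightarrow> (nat \<times> nat \<Rightarrow> bool) pmf" where
  "bits n = Pi_pmf (grid n) False (\<lambda>_. bernoulli_pmf p)"

abbreviation "Pr n \<equiv> measure_pmf.prob (bits n)"

definition wt :: "bool \<Rightarrow> real" where
  "wt t = (if t then p else q)"

lemma wt_simps [simp]: "wt True = p" "wt False = q"
  by (simp_all add: wt_def)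

lemma wt_pos: "0 < wt t"
  using p_pos p_less_1 by (simp add: wt_def)

lemma wt_le_max: "wt t \<le> max p q"
  by (simp add: wt_def)

lemma wt_ge_min: "min p q \<le> wt t"
  by (simp add: wt_def)

definition weight :: "nat \<Rightarrow> (nat \<times> nat \<Rightarrow> bool) \<Rightarrow> real" where
  "weight m b = (\<Prod>x\<in>grid m. wt (b x))"

text \<open>This is the probability that \<open>m\<close> fresh entries repeat column
  \<open>j\<close> of \<open>b\<close>. Applied to \<open>b \<circ> prod.swap\<close>,
  \<open>colwt\<close> and \<open>colsum\<close> describe rows.\<close>

definition colwt :: "nat \<Rightarrow> (nat \<times> nat \<Rightarrow> bool) \<Rightarrow> nat \<Rightarrow> real" where
  "colwt m b j = (\<Prod>i<m. wt (b (i, j)))"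

definition colsum :: "nat \<Rightarrow> nat \<Rightarrow> (nat \<times> nat \<Rightarrow> bool) \<Rightarrow> real" where
  "colsum m r b = (\<Sum>j<r. colwt m b j)"

lemma weight_pos: "0 < weight m b"
  by (simp add: weight_def prod_pos wt_pos)

lemma colwt_pos: "0 < colwt m b j"
  by (simp add: colwt_def prod_pos wt_pos)

lemma colsum_nonneg: "0 \<le> colsum m r b"
  by (simp add: colsum_def sum_nonneg colwt_pos less_imp_le)

lemma prob_bernoulli_single: "measure_pmf.prob (bernoulli_pmf p) {t} = wt t"
  using p_pos p_less_1 by (cases t) (simp_all add: measure_pmf_single)

lemma prob_cylinder:
  assumes "S \<subseteq> grid n"
  shows "Pr n {h. \<forall>x\<in>S. h x = f x} = (\<Prod>x\<in>S. wt (f x))"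
proof -
  \<comment> \<open>Coordinates outside \<open>S\<close> are unconstrained and contribute a factor
    1, so the product over the grid reduces to one over \<open>S\<close>.\<close>
  let ?B = "\<lambda>x. if x \<in> S then {f x} else UNIV"
  have "{h. \<forall>x\<in>S. h x = f x} = Pi (grid n) ?B"
    using assms by (auto simp: Pi_def simp del: split_paired_All)
  then have "Pr n {h. \<forall>x\<in>S. h x = f x}
      = (\<Prod>x\<in>grid n. measure_pmf.prob (bernoulli_pmf p) (?B x))"
    by (simp add: bits_def measure_Pi_pmf_Pi)
  also have "\<dots> = (\<Prod>x\<in>S. measure_pmf.prob (bernoulli_pmf p) (?B x))"
    using assms by (intro prod.mono_neutral_right) auto
  also have "\<dots> = (\<Prod>x\<in>S. wt (f x))"
    by (intro prod.cong refl) (simp add: prob_bernoulli_single)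
  finally show ?thesis .
qed

lemma prob_agree: "m \<le> n \<Longrightarrow> Pr n (agree m b) = weight m b"
  unfolding agree_def weight_def by (intro prob_cylinder grid_mono)

text \<open>The set \<open>J\<close> allows the new row to be prescribed only in part: it is empty
  for a zero column, a single index for a copied column, and all of \<open>{..<m}\<close> when
  column and row are both prescribed.\<close>

definition border ::
  "nat \<Rightarrow> nat set \<Rightarrow> (nat \<times> nat \<Rightarrow> bool) \<Rightarrow> (nat \<Rightarrow> bool) \<Rightarrow> (nat \<Rightarrow> bool) \<Rightarrow> bool
    \<Rightarrow> (nat \<times> nat \<Rightarrow> bool) set" where
  "border m J b u v t =
     {h \<in> agree m b. (\<forall>i<m. h (i, m) = u i) \<and> (\<forall>k\<in>J. h (m, k) = v k) \<and> h (m, m) = t}"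

lemma prob_border:
  assumes "m < n" and J: "J \<subseteq> {..<m}"
  shows "Pr n (border m J b u v t)
    = weight m b * (\<Prod>i<m. wt (u i)) * (\<Prod>k\<in>J. wt (v k)) * wt t"
proof -
  \<comment> \<open>The block, the new column, the new row and the corner are merged into one
    pattern, so that the event is a single cylinder.\<close>
  define F where "F = (\<lambda>x. if x \<in> grid m then b x else if fst x < m then u (fst x)
    else if snd x < m then v (snd x) else t)"
  let ?C = "(\<lambda>i. (i, m)) ` {..<m}" and ?R = "(\<lambda>k. (m, k)) ` J"
  have [simp]: "finite J" using J finite_subset by blast
  have notin: "k \<in> J \<Longrightarrow> k < m" for k using J by auto
  have F: "x \<in> grid m \<Longrightarrow> F x = b x" "i < m \<Longrightarrow> F (i, m) = u i"
    "k \<in> J \<Longrightarrow> F (m, k) = v k" "F (m, m) = t" for x i k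
    using notin by (auto simp: F_def)
  have "border m J b u v t = {h. \<forall>x\<in>grid m \<union> ?C \<union> ?R \<union> {(m, m)}. h x = F x}"
    unfolding border_def agree_def ball_Un ball_simps using F by auto
  also have "Pr n \<dots> = (\<Prod>x\<in>grid m \<union> ?C \<union> ?R \<union> {(m, m)}. wt (F x))"
    using assms notin by (intro prob_cylinder) (fastforce simp: grid_def)
  also have "\<dots> = (\<Prod>x\<in>grid m. wt (F x)) * (\<Prod>x\<in>?C. wt (F x)) * (\<Prod>x\<in>?R. wt (F x)) * wt t"
    using notin F(4) by (subst prod.union_disjoint, simp, simp, fastforce)+ simp
  also have "(\<Prod>x\<in>?C. wt (F x)) = (\<Prod>i<m. wt (u i))"
    by (subst prod.reindex) (auto simp: inj_on_def F)
  also have "(\<Prod>x\<in>?R. wt (F x)) = (\<Prod>k\<in>J. wt (v k))"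
    by (subst prod.reindex) (auto simp: inj_on_def F)
  also have "(\<Prod>x\<in>grid m. wt (F x)) = weight m b"
    unfolding weight_def by (intro prod.cong refl) (simp add: F)
  finally show ?thesis .
qed

text \<open>Transposition only permutes independent, identically distributed entries.\<close>

lemma bits_swap: "map_pmf (\<lambda>h. h \<circ> prod.swap) (bits n) = bits n"
  unfolding bits_def
  by (rule Pi_pmf_bij_betw[symmetric]) (auto simp: grid_def intro!: bij_betwI[where g = prod.swap])

lemma prob_swap: "Pr n {h. h \<circ> prod.swap \<in> A} = Pr n A"
  by (subst bits_swap[symmetric]) (simp add: measure_map_pmf vimage_def)

lemma weight_swap: "weight m (b \<circ> prod.swap) = weight m b"
  unfolding weight_def
  by (rule prod.reindex_bij_witness[of _ prod.swap prod.swap]) (auto simp: grid_def)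

subsection \<open>Singular one-step extensions\<close>

definition column_zero :: "nat \<Rightarrow> (nat \<times> nat \<Rightarrow> bool) \<Rightarrow> (nat \<times> nat \<Rightarrow> bool) set" where
  "column_zero m b = {h \<in> agree m b. (\<forall>i<m. \<not> h (i, m)) \<and> \<not> h (m, m)}"

definition column_copy :: "nat \<Rightarrow> (nat \<times> nat \<Rightarrow> bool) \<Rightarrow> nat \<Rightarrow> (nat \<times> nat \<Rightarrow> bool) set" where
  "column_copy m b j = {h \<in> agree m b. (\<forall>i<m. h (i, m) = b (i, j)) \<and> h (m, m) = h (m, j)}"

text \<open>Only the first \<open>r\<close> columns are candidates for copying. Later
  \<open>r = 9\<close>, so that their weights can be compared with those of the leading 9 x 9
  block.\<close>

definition bad_column :: "nat \<Rightarrow> nat \<Rightarrow> (nat \<times> nat \<Rightarrow> bool) \<Rightarrow> (nat \<times> nat \<Rightarrow> bool) set" where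
  "bad_column m r b = column_zero m b \<union> (\<Union>j<r. column_copy m b j)"

definition bad_row :: "nat \<Rightarrow> nat \<Rightarrow> (nat \<times> nat \<Rightarrow> bool) \<Rightarrow> (nat \<times> nat \<Rightarrow> bool) set" where
  "bad_row m r b = {h. h \<circ> prod.swap \<in> bad_column m r (b \<circ> prod.swap)}"

lemma prob_column_zero: "m < n \<Longrightarrow> Pr n (column_zero m b) = weight m b * q ^ Suc m"
proof -
  assume "m < n"
  have "column_zero m b = border m {} b (\<lambda>_. False) (\<lambda>_. False) False"
    by (auto simp: column_zero_def border_def)
  with prob_border[OF \<open>m < n\<close>] show ?thesis by simp
qed

text \<open>The corner must match the entry \<open>(m, j)\<close> of the new row. Both are fresh, so
  they agree with probability \<open>p^2 + q^2\<close>; the event is split by their common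
  value.\<close>

lemma prob_column_copy:
  assumes "m < n" "j < m"
  shows "Pr n (column_copy m b j) = weight m b * ((p^2 + q^2) * colwt m b j)"
proof -
  let ?E = "\<lambda>t. border m {j} b (\<lambda>i. b (i, j)) (\<lambda>_. t) t"
  have "column_copy m b j = ?E True \<union> ?E False"
    by (auto simp: column_copy_def border_def)
  moreover have "?E True \<inter> ?E False = {}"
    by (auto simp: border_def)
  ultimately have "Pr n (column_copy m b j) = Pr n (?E True) + Pr n (?E False)"
    by (simp add: measure_pmf.finite_measure_Union)
  also have "\<dots> = weight m b * ((p^2 + q^2) * colwt m b j)"
    using assms by (simp add: prob_border colwt_def algebra_simps power2_eq_square)
  finally show ?thesis .
qed

text \<open>The columns of a nonsingular block are distinct and nonzero already in the first
  \<open>m\<close> rows, so the events are disjoint and their probabilities add exactly.\<close>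

lemma prob_bad_column:
  assumes "m < n" "r \<le> m" and det: "Determinant.det (bmat m b) \<noteq> 0"
  shows "Pr n (bad_column m r b) = weight m b * (q ^ Suc m + (p^2 + q^2) * colsum m r b)"
proof -
  have "column_copy m b i \<inter> column_copy m b j = {}" if ij: "i < r" "j < r" "i \<noteq> j" for i j
  proof -
    have "i < m" "j < m" using ij assms by auto
    then obtain l where "l < m" "b (l, i) \<noteq> b (l, j)"
      using nonsingular_columns_distinct[OF det _ _ \<open>i \<noteq> j\<close>] by blast
    then show ?thesis by (auto simp: column_copy_def)
  qed
  then have "Pr n (\<Union>j<r. column_copy m b j) = (\<Sum>j<r. Pr n (column_copy m b j))"
    by (intro measure_pmf.finite_measure_finite_Union) (auto simp: disjoint_family_on_def)
  also have "\<dots> = weight m b * ((p^2 + q^2) * colsum m r b)"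
    using assms by (simp add: prob_column_copy colsum_def sum_distrib_left)
  finally have copies: "Pr n (\<Union>j<r. column_copy m b j) = weight m b * ((p^2 + q^2) * colsum m r b)" .
  have "column_zero m b \<inter> column_copy m b j = {}" if "j < r" for j
  proof -
    have "j < m" using that assms by auto
    then obtain l where "l < m" "b (l, j)"
      using nonsingular_column_nonzero[OF det] by blast
    then show ?thesis by (auto simp: column_copy_def column_zero_def)
  qed
  then have "column_zero m b \<inter> (\<Union>j<r. column_copy m b j) = {}" by blast
  then have "Pr n (bad_column m r b) = Pr n (column_zero m b) + Pr n (\<Union>j<r. column_copy m b j)"
    unfolding bad_column_def by (intro measure_pmf.finite_measure_Union) auto
  with copies show ?thesis
    using \<open>m < n\<close> by (simp add: prob_column_zero algebra_simps)
qed

lemma prob_bad_row: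
  assumes "m < n" "r \<le> m" "Determinant.det (bmat m b) \<noteq> 0"
  shows "Pr n (bad_row m r b)
    = weight m b * (q ^ Suc m + (p^2 + q^2) * colsum m r (b \<circ> prod.swap))"
  unfolding bad_row_def prob_swap
  using prob_bad_column[of m n r "b \<circ> prod.swap"] assms by (simp add: det_bmat_swap weight_swap)

text \<open>In each of the four combinations of zero or copied column and row the whole border is
  determined. A zero column or row forces the corner to be \<open>False\<close>; copies of column
  \<open>j\<close> and row \<open>i\<close> force it to be
  \<open>h (m, j) = b (i, j)\<close>.\<close>

lemma bad_column_row_subset:
  assumes "r \<le> m"
  shows "bad_column m r b \<inter> bad_row m r b \<subseteq>
    border m {..<m} b (\<lambda>_. False) (\<lambda>_. False) False
    \<union> (\<Union>j<r. border m {..<m} b (\<lambda>i. b (i, j)) (\<lambda>_. False) False)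
    \<union> (\<Union>i<r. border m {..<m} b (\<lambda>_. False) (\<lambda>k. b (i, k)) False)
    \<union> (\<Union>j<r. \<Union>i<r. border m {..<m} b (\<lambda>l. b (l, j)) (\<lambda>k. b (i, k)) (b (i, j)))"
    (is "_ \<subseteq> ?ZZ \<union> ?CZ \<union> ?ZR \<union> ?CR")
proof
  fix h assume h: "h \<in> bad_column m r b \<inter> bad_row m r b"
  then have agree: "h \<in> agree m b"
    by (auto simp: bad_column_def column_zero_def column_copy_def)
  have lt: "j < r \<Longrightarrow> j < m" for j using assms by simp
  from h consider (c0) "\<forall>i<m. \<not> h (i, m)" "\<not> h (m, m)"
    | (cj) j where "j < r" "\<forall>i<m. h (i, m) = b (i, j)" "h (m, m) = h (m, j)"
    unfolding bad_column_def column_zero_def column_copy_def by blast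
  note col = this
  from h consider (r0) "\<forall>k<m. \<not> h (m, k)" "\<not> h (m, m)"
    | (ri) i where "i < r" "\<forall>k<m. h (m, k) = b (i, k)" "h (m, m) = h (i, m)"
    unfolding bad_row_def bad_column_def column_zero_def column_copy_def by auto
  note row = this
  show "h \<in> ?ZZ \<union> ?CZ \<union> ?ZR \<union> ?CR"
  proof (cases rule: col)
    case c0
    show ?thesis
    proof (cases rule: row)
      case r0 with c0 agree have "h \<in> ?ZZ" by (simp add: border_def)
      then show ?thesis by blast
    next
      case ri with c0 agree have "h \<in> ?ZR" by (auto simp: border_def)
      then show ?thesis by blast
    qed
  next
    case (cj j)
    show ?thesis
    proof (cases rule: row)
      case r0 with cj agree have "h \<in> ?CZ" by (auto simp: border_def)
      then show ?thesis by blast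
    next
      case (ri i) with cj agree lt have "h \<in> ?CR" by (auto simp: border_def)
      then show ?thesis by blast
    qed
  qed
qed

text \<open>An upper bound suffices because the intersection enters inclusion-exclusion negatively,
  so the union bound is applied to the four cases.\<close>

lemma prob_bad_column_row:
  fixes b :: "nat \<times> nat \<Rightarrow> bool"
  assumes "m < n" "r \<le> m"
  defines "X \<equiv> colsum m r b" and "Y \<equiv> colsum m r (b \<circ> prod.swap)"
  shows "Pr n (bad_column m r b \<inter> bad_row m r b)
    \<le> weight m b * (q ^ (2 * m + 1) + q ^ Suc m * (X + Y) + max p q * X * Y)"
proof -
  let ?W = "weight m b" and ?x = "colwt m b" and ?y = "colwt m (b \<circ> prod.swap)"
  let ?zz = "border m {..<m} b (\<lambda>_. False) (\<lambda>_. False) False"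
  let ?cz = "\<lambda>j. border m {..<m} b (\<lambda>i. b (i, j)) (\<lambda>_. False) False"
  let ?zr = "\<lambda>i. border m {..<m} b (\<lambda>_. False) (\<lambda>k. b (i, k)) False"
  let ?cr = "\<lambda>j i. border m {..<m} b (\<lambda>l. b (l, j)) (\<lambda>k. b (i, k)) (b (i, j))"
  have y: "(\<Prod>k<m. wt (b (i, k))) = ?y i" for i by (simp add: colwt_def)
  have x: "(\<Prod>i<m. wt (b (i, j))) = ?x j" for j by (simp add: colwt_def)
  have zz: "Pr n ?zz = ?W * q ^ (2 * m + 1)"
  proof -
    have "q ^ (2 * m + 1) = q ^ m * q ^ m * q"
      by (simp add: power_add mult_2)
    then show ?thesis
      using assms(1) by (simp only: prob_border) simp
  qed
  have "Pr n (\<Union>j<r. ?cz j) \<le> (\<Sum>j<r. Pr n (?cz j))"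
    by (intro measure_pmf.finite_measure_subadditive_finite) auto
  also have "\<dots> = ?W * (q ^ Suc m * X)"
    using assms(1) unfolding X_def colsum_def sum_distrib_left
    by (intro sum.cong refl) (simp add: prob_border x algebra_simps)
  finally have cz: "Pr n (\<Union>j<r. ?cz j) \<le> ?W * (q ^ Suc m * X)" .
  have "Pr n (\<Union>i<r. ?zr i) \<le> (\<Sum>i<r. Pr n (?zr i))"
    by (intro measure_pmf.finite_measure_subadditive_finite) auto
  also have "\<dots> = ?W * (q ^ Suc m * Y)"
    using assms(1) unfolding Y_def colsum_def sum_distrib_left
    by (intro sum.cong refl) (simp add: prob_border y algebra_simps)
  finally have zr: "Pr n (\<Union>i<r. ?zr i) \<le> ?W * (q ^ Suc m * Y)" .
  have "Pr n (\<Union>j<r. \<Union>i<r. ?cr j i) \<le> (\<Sum>j<r. Pr n (\<Union>i<r. ?cr j i))"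
    by (intro measure_pmf.finite_measure_subadditive_finite) auto
  also have "\<dots> \<le> (\<Sum>j<r. \<Sum>i<r. Pr n (?cr j i))"
    by (intro sum_mono measure_pmf.finite_measure_subadditive_finite) auto
  also have "\<dots> \<le> (\<Sum>j<r. \<Sum>i<r. ?W * ?x j * ?y i * max p q)"
  proof (intro sum_mono)
    fix j i
    have "Pr n (?cr j i) = ?W * ?x j * ?y i * wt (b (i, j))"
      using assms(1) by (simp add: prob_border x y)
    \<comment> \<open>The corner weight depends on \<open>b (i, j)\<close>; bounding it uniformly
      lets the double sum factor into \<open>X * Y\<close>.\<close>
    also have "\<dots> \<le> ?W * ?x j * ?y i * max p q"
      by (intro mult_left_mono wt_le_max mult_nonneg_nonneg less_imp_le weight_pos colwt_pos)
    finally show "Pr n (?cr j i) \<le> ?W * ?x j * ?y i * max p q" .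
  qed
  also have "\<dots> = ?W * (max p q * X * Y)"
    unfolding X_def Y_def colsum_def
    by (simp add: sum_distrib_left sum_distrib_right mult_ac)
  finally have cr: "Pr n (\<Union>j<r. \<Union>i<r. ?cr j i) \<le> ?W * (max p q * X * Y)" .
  have "Pr n (bad_column m r b \<inter> bad_row m r b)
      \<le> Pr n (?zz \<union> (\<Union>j<r. ?cz j) \<union> (\<Union>i<r. ?zr i) \<union> (\<Union>j<r. \<Union>i<r. ?cr j i))"
    using bad_column_row_subset[OF assms(2)] by (intro measure_pmf.finite_measure_mono) auto
  also have "\<dots> \<le> Pr n ?zz + Pr n (\<Union>j<r. ?cz j) + Pr n (\<Union>i<r. ?zr i)
      + Pr n (\<Union>j<r. \<Union>i<r. ?cr j i)"
    by (intro order_trans[OF measure_Un_le] add_mono order_refl) auto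
  also have "\<dots> \<le> ?W * q ^ (2 * m + 1) + ?W * (q ^ Suc m * X) + ?W * (q ^ Suc m * Y)
      + ?W * (max p q * X * Y)"
    using zz cz zr cr by linarith
  finally show ?thesis by (simp add: algebra_simps)
qed

lemma bad_column_singular:
  assumes "h \<in> bad_column m r b" "r \<le> m"
  shows "h \<in> agree m b" "Determinant.det (bmat (Suc m) h) = 0"
proof -
  show "h \<in> agree m b"
    using assms by (auto simp: bad_column_def column_zero_def column_copy_def)
  then have agree: "i < m \<Longrightarrow> j < m \<Longrightarrow> h (i, j) = b (i, j)" for i j
    by (simp add: agree_def)
  consider "h \<in> column_zero m b" | j where "j < r" "h \<in> column_copy m b j"
    using assms by (auto simp: bad_column_def)
  then show "Determinant.det (bmat (Suc m) h) = 0"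
  proof cases
    case 1
    then show ?thesis
      by (intro det_bmat_zero_column[of m]) (auto simp: column_zero_def less_Suc_eq)
  next
    case (2 j)
    with \<open>r \<le> m\<close> agree show ?thesis
      by (intro det_bmat_eq_columns[of j _ m]) (auto simp: column_copy_def less_Suc_eq)
  qed
qed

lemma bad_row_singular:
  assumes "h \<in> bad_row m r b" "r \<le> m"
  shows "h \<in> agree m b" "Determinant.det (bmat (Suc m) h) = 0"
proof -
  have bad: "h \<circ> prod.swap \<in> bad_column m r (b \<circ> prod.swap)"
    using assms by (simp add: bad_row_def)
  from bad_column_singular(1)[OF bad assms(2)] show "h \<in> agree m b"
    by (force simp: agree_def grid_def)
  from bad_column_singular(2)[OF bad assms(2)] show "Determinant.det (bmat (Suc m) h) = 0"
    by (simp add: det_bmat_swap)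
qed

text \<open>Inclusion-exclusion for a bad column and a bad row, either of which makes the extended
  block singular.\<close>

lemma prob_singular_extension:
  fixes b :: "nat \<times> nat \<Rightarrow> bool"
  assumes "m < n" "r \<le> m" "Determinant.det (bmat m b) \<noteq> 0"
  defines "X \<equiv> colsum m r b" and "Y \<equiv> colsum m r (b \<circ> prod.swap)"
  shows "weight m b * (2 * q ^ Suc m - q ^ (2 * m + 1) + (p^2 + q^2 - q ^ Suc m) * (X + Y)
      - max p q * X * Y)
    \<le> Pr n {h \<in> agree m b. Determinant.det (bmat (Suc m) h) = 0}"
proof -
  let ?C = "bad_column m r b" and ?R = "bad_row m r b"
  have "Pr n (?C \<union> ?R) = Pr n ?C + Pr n ?R - Pr n (?C \<inter> ?R)"
    using measure_pmf.finite_measure_Union'[of ?C "bits n" ?R]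
      measure_pmf.finite_measure_Diff'[of ?R "bits n" ?C] by (simp add: Int_commute)
  moreover have "Pr n (?C \<union> ?R) \<le> Pr n {h \<in> agree m b. Determinant.det (bmat (Suc m) h) = 0}"
    using bad_column_singular bad_row_singular \<open>r \<le> m\<close>
    by (intro measure_pmf.finite_measure_mono) auto
  moreover note prob_bad_column_row[OF assms(1,2), of b, folded X_def Y_def]
    prob_bad_column[OF assms(1-3), folded X_def] prob_bad_row[OF assms(1-3), folded Y_def]
  ultimately show ?thesis by (simp add: algebra_simps)
qed

subsection \<open>Column weights of the leading block\<close>

lemma weight_conv_colwt: "weight m b = (\<Prod>j<m. colwt m b j)"
  unfolding weight_def grid_def colwt_def
  by (subst prod.swap) (simp add: prod.cartesian_product)

lemma weight_ones: "weight 9 b = p ^ ones b * q ^ (81 - ones b)"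
proof -
  have "weight 9 b = (\<Prod>x\<in>{x \<in> grid 9. b x}. wt (b x)) * (\<Prod>x\<in>{x \<in> grid 9. \<not> b x}. wt (b x))"
    unfolding weight_def
    by (subst prod.union_disjoint[symmetric]) (auto intro!: prod.cong)
  also have "(\<Prod>x\<in>{x \<in> grid 9. b x}. wt (b x)) = p ^ ones b"
    by (simp add: ones_def)
  also have "(\<Prod>x\<in>{x \<in> grid 9. \<not> b x}. wt (b x)) = q ^ card {x \<in> grid 9. \<not> b x}"
    by simp
  also have "card {x \<in> grid 9. \<not> b x} = 81 - ones b"
  proof -
    have "{x \<in> grid 9. \<not> b x} = grid 9 - {x \<in> grid 9. b x}" by auto
    then have "card {x \<in> grid 9. \<not> b x} = card (grid 9) - ones b"
      by (simp add: card_Diff_subset ones_def)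
    then show ?thesis by (simp add: grid_def)
  qed
  finally show ?thesis .
qed

text \<open>Nine times the geometric mean of the column weights of a 9 x 9 block with
  \<open>w\<close> ones: their product is the weight \<open>p^w * q^(81 - w)\<close> of the
  block.\<close>

definition gmean :: "nat \<Rightarrow> real" where
  "gmean w = 9 * p powr (real w / 9) * q powr (9 - real w / 9)"

lemma gmean_le_colsum: "gmean (ones b) \<le> colsum 9 9 b"
proof -
  have "9 * (\<Prod>j<9. colwt 9 b j) powr (1 / 9) \<le> colsum 9 9 b"
    using sum_ge_card_geometric_mean[of "{..<9::nat}" "colwt 9 b", OF _ _ colwt_pos]
    by (simp add: colsum_def lessThan_empty_iff)
  also have "(\<Prod>j<9. colwt 9 b j) = p powr ones b * q powr (81 - real (ones b))"
    using p_pos p_less_1 ones_le[of b]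
    by (simp add: weight_conv_colwt[symmetric] weight_ones powr_realpow of_nat_diff
        flip: powr_realpow)
  also have "\<dots> powr (1 / 9) = p powr (ones b / 9) * q powr (9 - ones b / 9)"
    using p_pos p_less_1 by (simp add: powr_mult powr_powr diff_divide_distrib)
  finally show ?thesis by (simp add: gmean_def mult.assoc)
qed

lemma colwt_le:
  assumes "l < 9" "wt (b (l, j)) \<le> a" "0 \<le> a"
  shows "colwt 9 b j \<le> a * max p q ^ 8"
proof -
  have "colwt 9 b j = wt (b (l, j)) * (\<Prod>i\<in>{..<9} - {l}. wt (b (i, j)))"
    unfolding colwt_def using assms by (subst prod.remove[of _ l]) auto
  also have "\<dots> \<le> a * (\<Prod>i\<in>{..<9} - {l}. max p q)"
    using assms wt_pos p_pos
    by (intro mult_mono prod_mono prod_nonneg) (auto intro: less_imp_le wt_le_max)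
  also have "(\<Prod>i\<in>{..<9} - {l}. max p q) = max p q ^ 8"
    using assms by simp
  finally show ?thesis .
qed

text \<open>Nonzero columns have weight at most \<open>p * q ^ 8\<close> if \<open>p < q\<close>; if \<open>p \<ge> q\<close>, at most one of
  the distinct columns is the all-ones column, and the others have weight at most \<open>q * p ^ 8\<close>.\<close>

lemma colsum_le:
  assumes det: "Determinant.det (bmat 9 b) \<noteq> 0"
  shows "colsum 9 9 b \<le> (p + 8 * min p q) * max p q ^ 8"
proof (cases "p < q")
  case True
  have "colwt 9 b j \<le> p * max p q ^ 8" if j: "j < 9" for j
  proof -
    obtain l where "l < 9" "b (l, j)"
      using nonsingular_column_nonzero[OF det j] .
    then show ?thesis using p_pos by (intro colwt_le) auto
  qed
  then have "colsum 9 9 b \<le> (\<Sum>j<9::nat. p * max p q ^ 8)"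
    unfolding colsum_def by (intro sum_mono) auto
  \<comment> \<open>Here \<open>min p q = p\<close>, so the nine equal bounds add up to
    \<open>p + 8 * min p q\<close> times the power.\<close>
  with True show ?thesis by (simp add: algebra_simps)
next
  case False
  define full where "full j \<longleftrightarrow> (\<forall>l<9. b (l, j))" for j
  \<comment> \<open>Here \<open>max p q = p\<close>, so this is the trivial bound
    \<open>p ^ 9\<close>; the choice of row 0 is arbitrary.\<close>
  have le_p: "colwt 9 b j \<le> p * max p q ^ 8" for j
    using False p_pos wt_le_max[of "b (0, j)"] by (intro colwt_le[of 0]) auto
  have le_q: "colwt 9 b j \<le> q * max p q ^ 8" if "\<not> full j" for j
    using that p_less_1 unfolding full_def by (auto intro!: colwt_le)
  have "\<exists>j0<9. \<forall>j<9. j \<noteq> j0 \<longrightarrow> \<not> full j"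
  proof (cases "\<exists>j0<9. full j0")
    case True
    then obtain j0 where j0: "j0 < 9" "full j0" by blast
    have "\<not> full j" if "j < 9" "j \<noteq> j0" for j
      using nonsingular_columns_distinct[OF det that(1) j0(1) that(2)] j0(2)
      unfolding full_def by metis
    with j0 show ?thesis by blast
  next
    case no: False
    then show ?thesis by (intro exI[of _ 0]) auto
  qed
  then obtain j0 where j0: "j0 < 9" "\<And>j. j < 9 \<Longrightarrow> j \<noteq> j0 \<Longrightarrow> \<not> full j" by blast
  have "colsum 9 9 b = colwt 9 b j0 + (\<Sum>j\<in>{..<9} - {j0}. colwt 9 b j)"
    unfolding colsum_def using j0 by (subst sum.remove[of _ j0]) auto
  also have "\<dots> \<le> p * max p q ^ 8 + (\<Sum>j\<in>{..<9} - {j0}. q * max p q ^ 8)"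
    using j0 le_p le_q by (intro add_mono sum_mono) auto
  also have "(\<Sum>j\<in>{..<9} - {j0}. q * max p q ^ 8) = 8 * (q * max p q ^ 8)"
    using j0 by simp
  also have "p * max p q ^ 8 + 8 * (q * max p q ^ 8) = (p + 8 * min p q) * max p q ^ 8"
    using False by (simp add: algebra_simps)
  finally show ?thesis .
qed

text \<open>Each of the \<open>m - 9\<close> entries below the leading block has weight between
  \<open>min p q\<close> and \<open>max p q\<close>. For \<open>k = Suc m\<close> the exponent
  \<open>m - 9\<close> is \<open>k - 10\<close>.\<close>

lemma colwt_extend:
  assumes "9 \<le> m"
  shows "min p q ^ (m - 9) * colwt 9 b j \<le> colwt m b j"
    "colwt m b j \<le> max p q ^ (m - 9) * colwt 9 b j"
proof -
  have split: "colwt m b j = (\<Prod>i\<in>{9..<m}. wt (b (i, j))) * colwt 9 b j"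
    unfolding colwt_def using assms
    by (subst prod.union_disjoint[symmetric]) (auto intro!: prod.cong)
  have "(\<Prod>i\<in>{9..<m}. min p q) \<le> (\<Prod>i\<in>{9..<m}. wt (b (i, j)))"
    using p_pos p_less_1 by (intro prod_mono) (auto simp: wt_ge_min)
  then show "min p q ^ (m - 9) * colwt 9 b j \<le> colwt m b j"
    unfolding split using colwt_pos[of 9 b j] by (intro mult_right_mono) auto
  have "(\<Prod>i\<in>{9..<m}. wt (b (i, j))) \<le> (\<Prod>i\<in>{9..<m}. max p q)"
    using wt_pos by (intro prod_mono) (auto simp: wt_le_max less_imp_le)
  then show "colwt m b j \<le> max p q ^ (m - 9) * colwt 9 b j"
    unfolding split using colwt_pos[of 9 b j] by (intro mult_right_mono) auto
qed

lemma colsum_extend: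
  assumes "9 \<le> m"
  shows "min p q ^ (m - 9) * colsum 9 9 b \<le> colsum m 9 b"
    "colsum m 9 b \<le> max p q ^ (m - 9) * colsum 9 9 b"
  unfolding colsum_def sum_distrib_left using colwt_extend[OF assms] by (auto intro!: sum_mono)

subsection \<open>Iterating the conditional bound\<close>

text \<open>For admissible \<open>k\<close> this bounds from below the conditional probability that
  the block of size \<open>k\<close> is singular, given a smaller block with nonzero leading minors
  and \<open>w\<close> ones in its leading 9 x 9 part.\<close>

definition gain :: "nat \<Rightarrow> nat \<Rightarrow> real" where
  "gain k w = 2 * q^k - q^(2 * k - 1)
     + 2 * ((p^2 + q^2) * min p q^(k - 10) - q^k * max p q^(k - 10)) * gmean w
     - max p q^(2 * k - 19) * (gmean w)^2"

text \<open>This is the hypothesis \<open>c * M \<le> a\<close> of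
  \<open>bilinear_lower_bound\<close>, for the coefficients that arise at size
  \<open>k\<close>.\<close>

definition admissible :: "nat \<Rightarrow> bool" where
  "admissible k \<longleftrightarrow> (p^2 + q^2) * min p q^(k - 10)
     \<ge> q^k * max p q^(k - 10) + (p + 8 * min p q) * max p q^(2 * k - 11)"

text \<open>The sums \<open>X\<close>, \<open>Y\<close> are compared with the sums \<open>S\<close>,
  \<open>S'\<close> of the 9 x 9 block, from below through \<alpha> where they count positively and
  from above through \<beta> where they count negatively. The bilinear bound then replaces
  \<open>S\<close> and \<open>S'\<close> by \<open>g\<close>.\<close>

lemma prob_singular_extension_ge_gain:
  assumes "9 \<le> m" "m < n" and SN: "minors_nonzero m b" and adm: "admissible (Suc m)"
  shows "weight m b * gain (Suc m) (ones b)
    \<le> Pr n {h \<in> agree m b. Determinant.det (bmat (Suc m) h) = 0}"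
proof -
  let ?\<alpha> = "min p q" and ?\<beta> = "max p q" and ?b' = "b \<circ> prod.swap" and ?k = "Suc m"
  define S S' where "S = colsum 9 9 b" and "S' = colsum 9 9 ?b'"
  define X Y where "X = colsum m 9 b" and "Y = colsum m 9 ?b'"
  define a where "a = (p^2 + q^2) * ?\<alpha> ^ (m - 9) - q ^ ?k * ?\<beta> ^ (m - 9)"
  define c where "c = ?\<beta> ^ (2 * m - 17)"
  define M where "M = (p + 8 * ?\<alpha>) * ?\<beta> ^ 8"
  define g where "g = gmean (ones b)"
  have det9: "Determinant.det (bmat 9 b) \<noteq> 0" and detm: "Determinant.det (bmat m b) \<noteq> 0"
    using minors_nonzero_det minors_nonzero_mono[OF SN] \<open>9 \<le> m\<close> by auto
  have \<beta>: "0 < ?\<beta>" using p_pos by simp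
  have X: "?\<alpha> ^ (m - 9) * S \<le> X" "X \<le> ?\<beta> ^ (m - 9) * S"
    and Y: "?\<alpha> ^ (m - 9) * S' \<le> Y" "Y \<le> ?\<beta> ^ (m - 9) * S'"
    using colsum_extend[OF \<open>9 \<le> m\<close>] by (simp_all add: X_def Y_def S_def S'_def)
  have nonneg: "0 \<le> S" "0 \<le> S'" "0 \<le> X" "0 \<le> Y"
    by (simp_all add: S_def S'_def X_def Y_def colsum_nonneg)
  have "2 * a * g - c * g^2 \<le> a * (S + S') - c * S * S'"
  proof (rule bilinear_lower_bound)
    show "g \<le> S" "g \<le> S'"
      using gmean_le_colsum[of b] gmean_le_colsum[of ?b'] by (simp_all add: g_def S_def S'_def ones_swap)
    show "S \<le> M" "S' \<le> M"
      using colsum_le[of b] colsum_le[of ?b'] det9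
      by (simp_all add: S_def S'_def M_def det_bmat_swap)
    show "0 \<le> c" using \<beta> by (simp add: c_def)
    \<comment> \<open>The factor \<open>M\<close> carries the eight further powers of
      \<beta>.\<close>
    have "2 * ?k - 11 = (2 * m - 17) + 8" using \<open>9 \<le> m\<close> by simp
    then have "c * M = (p + 8 * ?\<alpha>) * ?\<beta> ^ (2 * ?k - 11)"
      by (simp only: c_def M_def power_add mult_ac)
    then show "c * M \<le> a"
      using adm by (simp add: admissible_def a_def)
  qed
  moreover have "a * (S + S') - c * S * S' \<le> (p^2 + q^2 - q ^ ?k) * (X + Y) - ?\<beta> * X * Y"
  proof -
    have "(p^2 + q^2) * (?\<alpha> ^ (m - 9) * (S + S')) \<le> (p^2 + q^2) * (X + Y)"
      using X Y by (intro mult_left_mono) (auto simp: distrib_left)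
    moreover have "q ^ ?k * (X + Y) \<le> q ^ ?k * (?\<beta> ^ (m - 9) * (S + S'))"
      using X Y p_less_1 by (intro mult_left_mono) (auto simp: distrib_left)
    moreover have "?\<beta> * (X * Y) \<le> c * (S * S')"
    proof -
      have "?\<beta> * (X * Y) \<le> ?\<beta> * ((?\<beta> ^ (m - 9) * S) * (?\<beta> ^ (m - 9) * S'))"
        using X Y \<beta> nonneg by (intro mult_left_mono mult_mono mult_nonneg_nonneg) auto
      also have "\<dots> = ?\<beta> ^ (1 + (m - 9) + (m - 9)) * (S * S')"
        by (simp only: power_add power_one_right mult_ac)
      \<comment> \<open>One factor \<beta> comes from the corner and \<open>m - 9\<close> from each
        of the column and the row.\<close>
      also have "1 + (m - 9) + (m - 9) = 2 * m - 17" using \<open>9 \<le> m\<close> by simp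
      finally show ?thesis by (simp add: c_def)
    qed
    ultimately show ?thesis by (simp add: a_def algebra_simps)
  qed
  moreover have "gain ?k (ones b) = 2 * q ^ ?k - q ^ (2 * m + 1) + 2 * a * g - c * g^2"
  proof -
    have "2 * ?k - 1 = 2 * m + 1" "2 * ?k - 19 = 2 * m - 17" "?k - 10 = m - 9" by simp_all
    then show ?thesis by (simp only: gain_def a_def c_def g_def)
  qed
  ultimately have "gain ?k (ones b) \<le> 2 * q ^ ?k - q ^ (2 * m + 1)
      + (p^2 + q^2 - q ^ ?k) * (X + Y) - ?\<beta> * X * Y" by linarith
  then have "weight m b * gain ?k (ones b) \<le> weight m b * (2 * q ^ ?k - q ^ (2 * m + 1)
      + (p^2 + q^2 - q ^ ?k) * (X + Y) - ?\<beta> * X * Y)"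
    using weight_pos[of m b] by (intro mult_left_mono) auto
  also have "\<dots> \<le> Pr n {h \<in> agree m b. Determinant.det (bmat ?k h) = 0}"
    unfolding X_def Y_def using prob_singular_extension[OF \<open>m < n\<close> \<open>9 \<le> m\<close> detm] .
  finally show ?thesis .
qed

definition nonsing_ext :: "nat \<Rightarrow> (nat \<times> nat \<Rightarrow> bool) \<Rightarrow> (nat \<times> nat \<Rightarrow> bool) set" where
  "nonsing_ext m f = {h \<in> agree 9 f. minors_nonzero m h}"

lemma ones_agree: "h \<in> agree 9 f \<Longrightarrow> ones h = ones f"
  unfolding agree_def ones_def by (metis (mono_tags, lifting) Collect_cong mem_Collect_eq)

text \<open>The event is determined by the leading \<open>m\<close> x \<open>m\<close> block, so
  each cylinder \<open>agree m b\<close> lies inside it or misses it.\<close>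

lemma nonsing_ext_agree:
  assumes "9 \<le> m" "h \<in> agree m b"
  shows "h \<in> nonsing_ext m f \<longleftrightarrow> b \<in> nonsing_ext m f"
proof -
  have eq: "h x = b x" if "x \<in> grid m" for x
    using assms that by (simp add: agree_def)
  have "h \<in> agree 9 f \<longleftrightarrow> b \<in> agree 9 f"
    using eq grid_mono[OF assms(1)] unfolding agree_def mem_Collect_eq
    by (intro ball_cong refl) (metis subsetD)
  moreover have "minors_nonzero m h \<longleftrightarrow> minors_nonzero m b"
    using eq by (rule minors_nonzero_cong)
  ultimately show ?thesis by (simp add: nonsing_ext_def)
qed

text \<open>The inequality holds on each cylinder of an \<open>m\<close> x \<open>m\<close> block
  and is then summed. The factor is the same throughout because all blocks that contribute share the
  9 x 9 part \<open>f\<close>.\<close>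

lemma prob_nonsing_ext_Suc:
  assumes "9 \<le> m" "m < n" "admissible (Suc m)"
  shows "Pr n (nonsing_ext (Suc m) f) \<le> (1 - gain (Suc m) (ones f)) * Pr n (nonsing_ext m f)"
proof -
  let ?G = "gain (Suc m) (ones f)"
  have "Pr n (nonsing_ext (Suc m) f \<inter> agree m b) \<le> (1 - ?G) * Pr n (nonsing_ext m f \<inter> agree m b)"
    if "b \<in> conf m" for b
  proof (cases "b \<in> nonsing_ext m f")
    case True
    let ?sing = "{h \<in> agree m b. Determinant.det (bmat (Suc m) h) = 0}"
    have "ones b = ones f" "minors_nonzero m b"
      using True ones_agree by (auto simp: nonsing_ext_def)
    then have sing: "weight m b * ?G \<le> Pr n ?sing"
      using prob_singular_extension_ge_gain[OF assms(1,2) _ assms(3), of b] by simp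
    have "Pr n (nonsing_ext (Suc m) f \<inter> agree m b) \<le> Pr n (agree m b - ?sing)"
      by (intro measure_pmf.finite_measure_mono) (auto simp: nonsing_ext_def minors_nonzero_Suc)
    also have "\<dots> = Pr n (agree m b) - Pr n ?sing"
      by (intro measure_pmf.finite_measure_Diff) auto
    also have "\<dots> \<le> (1 - ?G) * weight m b"
      using sing \<open>m < n\<close> by (simp add: prob_agree algebra_simps)
    also have "weight m b = Pr n (nonsing_ext m f \<inter> agree m b)"
    proof -
      have "nonsing_ext m f \<inter> agree m b = agree m b"
        using nonsing_ext_agree[OF \<open>9 \<le> m\<close>] True by blast
      then show ?thesis using \<open>m < n\<close> by (simp add: prob_agree)
    qed
    finally show ?thesis .
  next
    case False
    then have "nonsing_ext m f \<inter> agree m b = {}"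
      using nonsing_ext_agree[OF \<open>9 \<le> m\<close>] by blast
    moreover from this have "nonsing_ext (Suc m) f \<inter> agree m b = {}"
      by (auto simp: nonsing_ext_def minors_nonzero_Suc)
    ultimately show ?thesis by simp
  qed
  then show ?thesis
    unfolding prob_conf_sum[of "bits n" "nonsing_ext (Suc m) f" m]
      prob_conf_sum[of "bits n" "nonsing_ext m f" m] sum_distrib_left
    by (rule sum_mono)
qed

text \<open>The factor \<open>1 - gain\<close> has to be nonnegative for the induction hypothesis to
  be multiplied by it.\<close>

lemma gain_le_1:
  assumes SN: "minors_nonzero 9 f" and "9 \<le> m" "admissible (Suc m)"
  shows "gain (Suc m) (ones f) \<le> 1"
proof -
  txt \<open>The bound on the conditional probability applies to some nonsingular extension of \<open>f\<close>.\<close>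
  define b where "b = identity_extension f"
  have "b \<in> agree 9 f"
    by (auto simp: b_def agree_def identity_extension_def grid_def)
  then have ones: "ones b = ones f" by (rule ones_agree)
  have "weight m b * gain (Suc m) (ones b)
      \<le> Pr (Suc m) {h \<in> agree m b. Determinant.det (bmat (Suc m) h) = 0}"
    using prob_singular_extension_ge_gain[OF \<open>9 \<le> m\<close> lessI _ assms(3)]
      minors_nonzero_identity_extension[OF SN \<open>9 \<le> m\<close>] by (simp add: b_def)
  also have "\<dots> \<le> Pr (Suc m) (agree m b)"
    by (intro measure_pmf.finite_measure_mono) auto
  also have "\<dots> = weight m b" by (simp add: prob_agree)
  finally show ?thesis
    using weight_pos[of m b] by (simp add: ones)
qed

text \<open>Induction on the size: an admissible step contributes its factor, while any other step
  uses only that the events decrease. At size 9 the product is empty.\<close>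

lemma prob_nonsing_ext:
  assumes "9 \<le> m" "m \<le> n" "minors_nonzero 9 f"
  shows "Pr n (nonsing_ext m f)
    \<le> weight 9 f * (\<Prod>k\<in>{k. 10 \<le> k \<and> k \<le> m \<and> admissible k}. 1 - gain k (ones f))"
  using assms(1,2)
proof (induction m rule: dec_induct)
  case base
  have "Pr n (nonsing_ext 9 f) \<le> Pr n (agree 9 f)"
    by (intro measure_pmf.finite_measure_mono) (auto simp: nonsing_ext_def)
  with base show ?case
    by (simp add: prob_agree Collect_conv_if cong: conj_cong)
next
  case (step m)
  let ?K = "\<lambda>m. {k. 10 \<le> k \<and> k \<le> m \<and> admissible k}"
  note IH = step.IH[OF Suc_leD[OF step.prems]]
  have fin: "finite (?K m)" by (rule finite_subset[of _ "{..m}"]) auto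
  show ?case
  proof (cases "admissible (Suc m)")
    case True
    have "?K (Suc m) = insert (Suc m) (?K m)" using True \<open>9 \<le> m\<close> by (auto simp: le_Suc_eq)
    then have prod: "(\<Prod>k\<in>?K (Suc m). 1 - gain k (ones f))
        = (1 - gain (Suc m) (ones f)) * (\<Prod>k\<in>?K m. 1 - gain k (ones f))"
      using fin by simp
    have "Pr n (nonsing_ext (Suc m) f) \<le> (1 - gain (Suc m) (ones f)) * Pr n (nonsing_ext m f)"
      using prob_nonsing_ext_Suc step True by simp
    also have "\<dots> \<le> (1 - gain (Suc m) (ones f))
        * (weight 9 f * (\<Prod>k\<in>?K m. 1 - gain k (ones f)))"
      using IH gain_le_1[OF assms(3) step.hyps(1) True] by (intro mult_left_mono) auto
    finally show ?thesis by (simp add: prod mult_ac)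
  next
    case False
    then have "?K (Suc m) = ?K m" by (auto simp: le_Suc_eq)
    moreover have "Pr n (nonsing_ext (Suc m) f) \<le> Pr n (nonsing_ext m f)"
      by (intro measure_pmf.finite_measure_mono) (auto simp: nonsing_ext_def minors_nonzero_Suc)
    ultimately show ?thesis using IH by simp
  qed
qed

lemma prob_minors_nonzero_le:
  assumes "9 \<le> n"
  shows "Pr n {h. minors_nonzero n h} \<le>
    (\<Sum>w = 9..73. real (num_strongly_nonsingular 9 w) * p^w * q^(81 - w) *
       (\<Prod>k\<in>{k. 10 \<le> k \<and> k \<le> n \<and> admissible k}. 1 - gain k w))"
proof -
  let ?K = "{k. 10 \<le> k \<and> k \<le> n \<and> admissible k}"
  let ?F = "{f \<in> conf 9. minors_nonzero 9 f}"
  define B where "B w = p^w * q^(81 - w) * (\<Prod>k\<in>?K. 1 - gain k w)" for w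
  have "Pr n {h. minors_nonzero n h} = (\<Sum>f\<in>conf 9. Pr n (nonsing_ext n f))"
    by (subst prob_conf_sum[of _ _ 9]) (simp add: nonsing_ext_def Int_def conj_commute)
  also have "\<dots> = (\<Sum>f\<in>?F. Pr n (nonsing_ext n f))"
  proof (intro sum.mono_neutral_right ballI)
    fix f assume f: "f \<in> conf 9 - ?F"
    have "minors_nonzero 9 f" if "h \<in> nonsing_ext n f" for h
      using that minors_nonzero_cong[of 9 h f] minors_nonzero_mono[OF _ assms]
      by (auto simp: nonsing_ext_def agree_def)
    with f have "nonsing_ext n f = {}" by blast
    then show "Pr n (nonsing_ext n f) = 0" by simp
  qed auto
  also have "\<dots> \<le> (\<Sum>f\<in>?F. B (ones f))"
    using prob_nonsing_ext[OF assms order_refl]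
    by (intro sum_mono) (simp add: B_def weight_ones)
  \<comment> \<open>By \<open>ones_bounds\<close> every remaining block has between 9 and 73 ones,
    so grouping by \<open>w\<close> loses no term.\<close>
  also have "\<dots> = (\<Sum>w = 9..73. \<Sum>f\<in>{f \<in> ?F. ones f = w}. B (ones f))"
    using ones_bounds minors_nonzero_det by (intro sum.group[symmetric]) auto
  also have "\<dots> = (\<Sum>w = 9..73. real (num_strongly_nonsingular 9 w) * B w)"
    by (intro sum.cong refl) (simp add: num_strongly_nonsingular_eq conj_assoc)
  finally show ?thesis by (simp add: B_def mult.assoc)
qed

lemma prob_strongly_nonsingular_eq: "prob_strongly_nonsingular n p = Pr n {h. minors_nonzero n h}"
  by (simp add: prob_strongly_nonsingular_def bernoulli_mat_def bits_def grid_def measure_map_pmf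
      vimage_def strongly_nonsingular_bmat flip: bmat_def)

end

theorem theorem5p1:
  fixes n :: nat and p q \<alpha> \<beta> :: real and g :: "nat \<Rightarrow> real" and T :: "nat set"
  assumes "n > 9" and "0 < p" and "p < 1"
    and "q = 1 - p" and "\<alpha> = min p q" and "\<beta> = max p q"
    and "\<And>w. g w = 9 * p powr (real w / 9) * q powr (9 - real w / 9)"
    and "T = {k. 10 \<le> k \<and> k \<le> n \<and>
               (p^2 + q^2) * \<alpha>^(k - 10) \<ge> q^k * \<beta>^(k - 10) + (p + 8 * \<alpha>) * \<beta>^(2 * k - 11)}"
  shows "prob_strongly_nonsingular n p \<le>
    (\<Sum>w = 9..73. real (num_strongly_nonsingular 9 w) * p^w * q^(81 - w) *
       (\<Prod>k\<in>T. 1 - (2 * q^k - q^(2 * k - 1)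
                     + 2 * ((p^2 + q^2) * \<alpha>^(k - 10) - q^k * \<beta>^(k - 10)) * g w
                     - \<beta>^(2 * k - 19) * (g w)^2)))"
proof -
  interpret bernoulli_entries p by unfold_locales fact+
  have "g = gmean"
    using assms(4,7) by (simp add: fun_eq_iff gmean_def)
  moreover have "T = {k. 10 \<le> k \<and> k \<le> n \<and> admissible k}"
    using assms(4-6,8) by (simp add: admissible_def)
  ultimately show ?thesis
    using prob_minors_nonzero_le[of n] assms(1,4-6)
    by (simp add: prob_strongly_nonsingular_eq gain_def)
qed

end
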